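(* Let $1<p<\infty$, let $(X,d)$ be a locally compact separable metric space, and let $\mathfrak m$ be a Radon measure on $(X,d)$ with full support. Let $(\mathcal E,\mathcal F)$ and $(\tilde{\mathcal E},\mathcal F)$ be $p$-energy forms on $(X,\mathfrak m)$ with common domain $\mathcal F$, both satisfying conditions (E1)–(E4) written out in the context. Let $\{\mu_{\langle f\rangle}\}_{f\in\mathcal F}$ and $\{\nu_{\langle f\rangle}\}_{f\in\mathcal F}$ be families of Radon measures on $(X,d)$ such that $\{\mu_{\langle f\rangle}\}$ satisfies the following four conditions with respect to $(\mathcal E,\mathcal F)$, and $\{\nu_{\langle f\rangle}\}$ satisfies the same four conditions with respect to $(\tilde{\mathcal E},\mathcal F)$ (i.e. with $\mu,\mathcal E$ replaced by $\nu,\tilde{\mathcal E}$): (i) $\mu_{\langle f\rangle}(X)=\mathcal E(f)$ for any $f\in\mathcal F$; (ii) if $f,g\in\mathcal F\cap C_c(X)$, $A\in\mathcal B(X)$ and $(f-g)|_A$ is constant, then $\mu_{\langle f\rangle}(A)=\mu_{\langle g\rangle}(A)$; (iii) $\mu_{\langle f\rangle}=\mu_{\langle -f\rangle}$ for any $f\in\mathcal F$; (iv) for $f,f_n\in\mathcal F$ $(n\ge1)$, if $\lim_{n\to\infty}\mathcal E(f-f_n)=0$, then $\lim_{n\to\infty}\mu_{\langle f_n\rangle}(A)=\mu_{\langle f\rangle}(A)$ for any $A\in\mathcal B(X)$. If $\mathcal E(f)\le\tilde{\mathcal E}(f)$ for every $f\in\mathcal F\cap C_c(X)$, then $\mu_{\langle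 f\rangle}(A)\le\nu_{\langle f\rangle}(A)$ for every $f\in\mathcal F$ and every $A\in\mathcal B(X)$.
   Context: $C_c(X)$ is the set of continuous real functions on $X$ with compact support, $\operatorname{supp}(f)=\overline{\{f\neq0\}}$, $\mathcal B(X)$ is the Borel $\sigma$-algebra, $a\wedge b=\min\{a,b\}$, $a^+=\max\{a,0\}$. A $p$-energy form on $(X,\mathfrak m)$ is a pair $(\mathcal E,\mathcal F)$ where $\mathcal F$ is a linear subspace of the space $L^0(\mathfrak m)$ of measurable functions modulo $\mathfrak m$-a.e. equality and $\mathcal E:\mathcal F\to[0,\infty)$ is such that $\mathcal E^{1/p}$ is a seminorm. $\mathcal F\cap C_c(X)$ is the set of $f\in C_c(X)$ whose $\mathfrak m$-class is in $\mathcal F$. Conditions (stated for $\mathcal E$; likewise for $\tilde{\mathcal E}$): (E1) $\mathcal F\subset L^p(\mathfrak m)$ and $(\mathcal F,\|\cdot\|_{\mathcal E_1})$ is a Banach space, where $\|f\|_{\mathcal E_1}=(\mathcal E(f)+\|f\|_{L^p(\mathfrak m)}^p)^{1/p}$. (E2) If $f\in\mathcal F\cap C_c(X)$, then $g:=(f\wedge1)^+\in\mathcal F\cap C_c(X)$ and $\mathcal E(g)\le\mathcal E(f)$. (E3) $\mathcal E(f+g)=\mathcal E(f)+\mathcal E(g)$ if $f,g\in\mathcal F\cap C_c(X)$ and $\operatorname{supp}(f)\cap\operatorname{supp}(g+a)=\emptyset$ for some $a\in\mathbb R$. (E4) $\mathcal F\cap C_c(X)$ is dense both in $(\mathcal F,\|\cdot\|_{\mathcal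 E_1})$ and in $(C_c(X),\|\cdot\|_\infty)$. *)

theory Defs
  imports "HOL-Analysis.Analysis"
begin

definition radon_measure :: "'a::metric_space measure \<Rightarrow> bool" where
  "radon_measure M \<longleftrightarrow>
     sets M = sets borel \<and>
     (\<forall>x. \<exists>U. open U \<and> x \<in> U \<and> emeasure M U < \<infinity>) \<and>
     (\<forall>A\<in>sets borel. emeasure M A = (SUP K\<in>{K. compact K \<and> K \<subseteq> A}. emeasure M K))"

definition full_support :: "'a::metric_space measure \<Rightarrow> bool" where
  "full_support M \<longleftrightarrow> (\<forall>U. open U \<and> U \<noteq> {} \<longrightarrow> emeasure M U > 0)"

definition supp :: "('a::metric_space \<Rightarrow> real) \<Rightarrow> 'a set" where
  "supp f = closure {x. f x \<noteq> 0}"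

definition Cc :: "('a::metric_space \<Rightarrow> real) set" where
  "Cc = {f. continuous_on UNIV f \<and> compact (supp f)}"

definition sup_norm :: "('a \<Rightarrow> real) \<Rightarrow> real" where
  "sup_norm f = (SUP x. \<bar>f x\<bar>)"

text \<open>A set of elements of $L^0(m)$, that is, of measurable functions modulo almost everywhere
  equality, is encoded as the set of all representatives of its elements, which is a set of
  measurable functions closed under almost everywhere equality. An object that depends on an
  element of $L^0(m)$ is encoded as a function of the representative whose value is the same on
  almost everywhere equal representatives. With this encoding \<^term>\<open>F \<inter> Cc\<close> is
  the set of functions in \<^term>\<open>Cc\<close> whose class belongs to the encoded space.\<close>

definition L0_subspace :: "'a::metric_space measure \<Rightarrow> ('a \<Rightarrow> real) set \<Rightarrow> bool" where
  "L0_subspace m F \<longleftrightarrow>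
     F \<subseteq> borel_measurable m \<and>
     (\<forall>f\<in>F. \<forall>g\<in>borel_measurable m. (AE x in m. f x = g x) \<longrightarrow> g \<in> F) \<and>
     (\<lambda>x. 0) \<in> F \<and>
     (\<forall>f\<in>F. \<forall>g\<in>F. (\<lambda>x. f x + g x) \<in> F) \<and>
     (\<forall>f\<in>F. \<forall>c. (\<lambda>x. c * f x) \<in> F)"

definition respects_AE ::
    "'a::metric_space measure \<Rightarrow> ('a \<Rightarrow> real) set \<Rightarrow> (('a \<Rightarrow> real) \<Rightarrow> 'b) \<Rightarrow> bool" where
  "respects_AE m F T \<longleftrightarrow> (\<forall>f\<in>F. \<forall>g\<in>F. (AE x in m. f x = g x) \<longrightarrow> T f = T g)"

definition seminorm_on :: "('a \<Rightarrow> real) set \<Rightarrow> (('a \<Rightarrow> real) \<Rightarrow> real) \<Rightarrow> bool" where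
  "seminorm_on F N \<longleftrightarrow>
     (\<forall>f\<in>F. 0 \<le> N f) \<and>
     (\<forall>f\<in>F. \<forall>c. N (\<lambda>x. c * f x) = \<bar>c\<bar> * N f) \<and>
     (\<forall>f\<in>F. \<forall>g\<in>F. N (\<lambda>x. f x + g x) \<le> N f + N g)"

definition banach_on ::
    "'a::metric_space measure \<Rightarrow> ('a \<Rightarrow> real) set \<Rightarrow> (('a \<Rightarrow> real) \<Rightarrow> real) \<Rightarrow> bool" where
  "banach_on m F N \<longleftrightarrow>
     seminorm_on F N \<and>
     (\<forall>f\<in>F. N f = 0 \<longrightarrow> (AE x in m. f x = 0)) \<and>
     (\<forall>u. (\<forall>n::nat. u n \<in> F) \<and>
          (\<forall>\<epsilon>>0. \<exists>n0. \<forall>i\<ge>n0. \<forall>j\<ge>n0. N (\<lambda>x. u i x - u j x) < \<epsilon>) \<longrightarrow>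
          (\<exists>f\<in>F. (\<lambda>n. N (\<lambda>x. u n x - f x)) \<longlonglongrightarrow> 0))"

definition dense_wrt ::
    "(('a \<Rightarrow> real) \<Rightarrow> real) \<Rightarrow> ('a \<Rightarrow> real) set \<Rightarrow> ('a \<Rightarrow> real) set \<Rightarrow> bool" where
  "dense_wrt N D V \<longleftrightarrow> D \<subseteq> V \<and> (\<forall>f\<in>V. \<forall>\<epsilon>>0. \<exists>g\<in>D. N (\<lambda>x. f x - g x) < \<epsilon>)"

definition Lp_space :: "real \<Rightarrow> 'a measure \<Rightarrow> ('a \<Rightarrow> real) set" where
  "Lp_space p m = {f \<in> borel_measurable m. integrable m (\<lambda>x. \<bar>f x\<bar> powr p)}"

definition Lp_norm :: "real \<Rightarrow> 'a measure \<Rightarrow> ('a \<Rightarrow> real) \<Rightarrow> real" where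
  "Lp_norm p m f = (integral\<^sup>L m (\<lambda>x. \<bar>f x\<bar> powr p)) powr (1 / p)"

definition energy_norm ::
    "real \<Rightarrow> 'a measure \<Rightarrow> (('a \<Rightarrow> real) \<Rightarrow> real) \<Rightarrow> ('a \<Rightarrow> real) \<Rightarrow> real" where
  "energy_norm p m E f = (E f + Lp_norm p m f powr p) powr (1 / p)"

definition energy_form ::
    "real \<Rightarrow> 'a::metric_space measure \<Rightarrow> (('a \<Rightarrow> real) \<Rightarrow> real) \<Rightarrow> ('a \<Rightarrow> real) set \<Rightarrow> bool" where
  "energy_form p m E F \<longleftrightarrow>
     L0_subspace m F \<and>
     respects_AE m F E \<and>
     (\<forall>f\<in>F. 0 \<le> E f) \<and>
     seminorm_on F (\<lambda>f. E f powr (1 / p))"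

definition E1 ::
    "real \<Rightarrow> 'a::metric_space measure \<Rightarrow> (('a \<Rightarrow> real) \<Rightarrow> real) \<Rightarrow> ('a \<Rightarrow> real) set \<Rightarrow> bool" where
  "E1 p m E F \<longleftrightarrow> F \<subseteq> Lp_space p m \<and> banach_on m F (energy_norm p m E)"

definition E2 :: "(('a::metric_space \<Rightarrow> real) \<Rightarrow> real) \<Rightarrow> ('a \<Rightarrow> real) set \<Rightarrow> bool" where
  "E2 E F \<longleftrightarrow>
     (\<forall>f\<in>F \<inter> Cc. (\<lambda>x. max (min (f x) 1) 0) \<in> F \<inter> Cc \<and>
                  E (\<lambda>x. max (min (f x) 1) 0) \<le> E f)"

definition E3 :: "(('a::metric_space \<Rightarrow> real) \<Rightarrow> real) \<Rightarrow> ('a \<Rightarrow> real) set \<Rightarrow> bool" where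
  "E3 E F \<longleftrightarrow>
     (\<forall>f\<in>F \<inter> Cc. \<forall>g\<in>F \<inter> Cc.
        (\<exists>a. supp f \<inter> supp (\<lambda>x. g x + a) = {}) \<longrightarrow> E (\<lambda>x. f x + g x) = E f + E g)"

definition E4 ::
    "real \<Rightarrow> 'a::metric_space measure \<Rightarrow> (('a \<Rightarrow> real) \<Rightarrow> real) \<Rightarrow> ('a \<Rightarrow> real) set \<Rightarrow> bool" where
  "E4 p m E F \<longleftrightarrow>
     dense_wrt (energy_norm p m E) (F \<inter> Cc) F \<and> dense_wrt sup_norm (F \<inter> Cc) Cc"

definition energy_measures ::
    "'a::metric_space measure \<Rightarrow> (('a \<Rightarrow> real) \<Rightarrow> real) \<Rightarrow> ('a \<Rightarrow> real) set
       \<Rightarrow> (('a \<Rightarrow> real) \<Rightarrow> 'a measure) \<Rightarrow> bool" where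
  "energy_measures m E F \<mu> \<longleftrightarrow>
     respects_AE m F \<mu> \<and>
     (\<forall>f\<in>F. radon_measure (\<mu> f)) \<and>
     (\<forall>f\<in>F. emeasure (\<mu> f) UNIV = ennreal (E f)) \<and>
     (\<forall>f\<in>F \<inter> Cc. \<forall>g\<in>F \<inter> Cc. \<forall>A\<in>sets borel.
        (\<lambda>x. f x - g x) constant_on A \<longrightarrow> emeasure (\<mu> f) A = emeasure (\<mu> g) A) \<and>
     (\<forall>f\<in>F. \<mu> f = \<mu> (\<lambda>x. - f x)) \<and>
     (\<forall>f\<in>F. \<forall>u. (\<forall>n::nat. u n \<in> F) \<and> (\<lambda>n. E (\<lambda>x. f x - u n x)) \<longlonglongrightarrow> 0 \<longrightarrow>
        (\<forall>A\<in>sets borel. (\<lambda>n. emeasure (\<mu> (u n)) A) \<longlonglongrightarrow> emeasure (\<mu> f) A))"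

end

theory Submission
  imports Defs
begin

text \<open>
  An energy measure does not charge sets on which the function vanishes, and it does not see the
  difference between \<open>f\<close> and \<open>c - f\<close>. Folding the range of \<open>f\<close> repeatedly therefore yields
  functions \<open>h\<close> of arbitrarily small oscillation with the same energy measure as \<open>f\<close>. If
  \<open>\<phi> \<ge> 0\<close> is a fixed function in the core and \<open>0 \<le> h \<le> \<epsilon>\<close>, then \<open>min h \<phi>\<close> has the measure of
  \<open>f\<close> where \<open>\<phi> \<ge> \<epsilon>\<close>, none where \<open>\<phi> = 0\<close>, and at most an extra contribution of \<open>\<phi>\<close> on
  \<open>0 < \<phi> < \<epsilon>\<close>, which vanishes as \<open>\<epsilon>\<close> tends to \<open>0\<close>. So the inequality between the total
  energies of these functions localises to the set \<open>\<phi> > 0\<close>; such sets separate compact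
  sets from closed ones, and regularity and density do the rest.
\<close>

section \<open>Continuous functions of compact support\<close>

lemma Cc_add:
  assumes "f \<in> Cc" "g \<in> Cc"
  shows "(\<lambda>x. f x + g x) \<in> Cc"
proof -
  have "{x. f x + g x \<noteq> 0} \<subseteq> {x. f x \<noteq> 0} \<union> {x. g x \<noteq> 0}" by auto
  from closure_mono[OF this] have "supp (\<lambda>x. f x + g x) \<subseteq> supp f \<union> supp g"
    unfolding supp_def by simp
  moreover have "compact (supp f \<union> supp g)" using assms by (auto simp: Cc_def)
  moreover have "closed (supp (\<lambda>x. f x + g x))" by (simp add: supp_def)
  ultimately have "compact (supp (\<lambda>x. f x + g x))"
    by (metis compact_Int_closed inf.absorb2)
  then show ?thesis using assms by (auto simp: Cc_def intro!: continuous_intros)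
qed

lemma Cc_scale:
  assumes "f \<in> Cc"
  shows "(\<lambda>x. c * f x) \<in> Cc"
proof -
  have "supp (\<lambda>x. c * f x) = (if c = 0 then {} else supp f)" by (auto simp: supp_def)
  then show ?thesis using assms by (auto simp: Cc_def intro!: continuous_intros)
qed

lemma Cc_bounded:
  assumes "f \<in> Cc"
  obtains M where "0 < M" "\<And>x. \<bar>f x\<bar> \<le> M"
proof -
  have "continuous_on (supp f) f" "compact (supp f)"
    using assms by (auto simp: Cc_def intro: continuous_on_subset)
  then have "bounded (f ` supp f)"
    using compact_continuous_image compact_imp_bounded by blast
  then obtain M where M: "0 < M" "\<And>x. x \<in> supp f \<Longrightarrow> \<bar>f x\<bar> \<le> M"
    by (auto simp: bounded_pos)
  have "f x = 0" if "x \<notin> supp f" for x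
    using that closure_subset[of "{x. f x \<noteq> 0}"] by (auto simp: supp_def)
  then have "\<bar>f x\<bar> \<le> M" for x using M by (cases "x \<in> supp f") auto
  with M(1) show ?thesis by (rule that)
qed

text \<open>A real supremum says something only about a set that is bounded above. Compact support
  supplies the bound.\<close>

lemma sup_norm_upper:
  assumes "f \<in> Cc"
  shows "\<bar>f x\<bar> \<le> sup_norm f"
proof -
  obtain M where M: "\<And>x. \<bar>f x\<bar> \<le> M" using Cc_bounded assms by metis
  have "bdd_above (range (\<lambda>x. \<bar>f x\<bar>))" using M by (rule bdd_aboveI2)
  then show ?thesis unfolding sup_norm_def by (intro cSUP_upper) auto
qed

section \<open>Lattice operations on the core \<open>F \<inter> Cc\<close>\<close>

lemma core_zero:
  assumes "L0_subspace m F"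
  shows "(\<lambda>x. 0) \<in> F \<inter> Cc"
  using assms by (auto simp: L0_subspace_def Cc_def supp_def)

lemma core_add:
  assumes "L0_subspace m F" "f \<in> F \<inter> Cc" "g \<in> F \<inter> Cc"
  shows "(\<lambda>x. f x + g x) \<in> F \<inter> Cc"
  using assms Cc_add by (auto simp: L0_subspace_def)

lemma core_scale:
  assumes "L0_subspace m F" "f \<in> F \<inter> Cc"
  shows "(\<lambda>x. c * f x) \<in> F \<inter> Cc"
  using assms Cc_scale by (auto simp: L0_subspace_def)

lemma core_diff:
  assumes "L0_subspace m F" "f \<in> F \<inter> Cc" "g \<in> F \<inter> Cc"
  shows "(\<lambda>x. f x - g x) \<in> F \<inter> Cc"
  using core_add[OF assms(1,2) core_scale[OF assms(1,3), of "-1"]] by simp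

text \<open>(E2) cuts at height 1 only. Rescaling by \<open>1 / c\<close> before the cut and by
  \<open>c\<close> after it moves the height to \<open>c\<close>.\<close>

lemma core_cut:
  assumes L: "L0_subspace m F" and E2: "E2 E F" and f: "f \<in> F \<inter> Cc" and c: "0 < c"
  shows "(\<lambda>x. max (min (f x) c) 0) \<in> F \<inter> Cc"
proof -
  have "(\<lambda>x. max (min ((1 / c) * f x) 1) 0) \<in> F \<inter> Cc"
    using bspec[OF E2[unfolded E2_def] core_scale[OF L f, of "1 / c"]] by (rule conjunct1)
  from core_scale[OF L this, of c]
  have "(\<lambda>x. c * max (min ((1 / c) * f x) 1) 0) \<in> F \<inter> Cc" .
  moreover have "c * max (min ((1 / c) * y) 1) 0 = max (min y c) 0" for y
    using c by (auto simp: max_def min_def field_simps)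
  ultimately show ?thesis by simp
qed

text \<open>A function in \<open>Cc\<close> is bounded, so a cut at a height above its bound removes
  only the negative part.\<close>

lemma core_pos_part:
  assumes L: "L0_subspace m F" and E2: "E2 E F" and f: "f \<in> F \<inter> Cc"
  shows "(\<lambda>x. max (f x) 0) \<in> F \<inter> Cc"
proof -
  obtain M where M: "0 < M" "\<And>x. \<bar>f x\<bar> \<le> M" using Cc_bounded f by blast
  then have "max (min (f x) M) 0 = max (f x) 0" for x
    by (metis abs_le_D1 min.absorb1)
  then show ?thesis using core_cut[OF L E2 f M(1)] by simp
qed

text \<open>The excess over \<open>c\<close> is what the cut at height \<open>c\<close> takes away
  from the positive part. It serves below to fold a function at level \<open>c\<close> and to turn
  approximate zeros into exact ones.\<close>

lemma core_excess:
  assumes L: "L0_subspace m F" and E2: "E2 E F" and f: "f \<in> F \<inter> Cc" and c: "0 < c"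
  shows "(\<lambda>x. max (f x - c) 0) \<in> F \<inter> Cc"
proof -
  have "max y 0 - max (min y c) 0 = max (y - c) 0" for y using c by auto
  then show ?thesis
    using core_diff[OF L core_pos_part[OF L E2 f] core_cut[OF L E2 f c]] by simp
qed

lemma core_abs:
  assumes L: "L0_subspace m F" and E2: "E2 E F" and f: "f \<in> F \<inter> Cc"
  shows "(\<lambda>x. \<bar>f x\<bar>) \<in> F \<inter> Cc"
proof -
  have "max y 0 + max (-1 * y) 0 = \<bar>y\<bar>" for y :: real by auto
  then show ?thesis
    using core_add[OF L core_pos_part[OF L E2 f] core_pos_part[OF L E2 core_scale[OF L f, of "-1"]]]
    by simp
qed

lemma core_min:
  assumes L: "L0_subspace m F" and E2: "E2 E F" and f: "f \<in> F \<inter> Cc" and g: "g \<in> F \<inter> Cc"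
  shows "(\<lambda>x. min (f x) (g x)) \<in> F \<inter> Cc"
proof -
  have "y - max (y - z) 0 = min y z" for y z :: real by auto
  then show ?thesis
    using core_diff[OF L f core_pos_part[OF L E2 core_diff[OF L f g]]] by simp
qed

section \<open>Elementary consequences of the energy form and energy measure axioms\<close>

lemma respects_AED:
  assumes "respects_AE m F T" "f \<in> F" "g \<in> F" "AE x in m. f x = g x"
  shows "T f = T g"
  using assms unfolding respects_AE_def by blast

lemma seminorm_on_scale:
  assumes "seminorm_on F N" "f \<in> F"
  shows "N (\<lambda>x. c * f x) = \<bar>c\<bar> * N f"
  using assms by (simp add: seminorm_on_def)

lemma seminorm_on_triangle:
  assumes "seminorm_on F N" "f \<in> F" "g \<in> F"
  shows "N (\<lambda>x. f x + g x) \<le> N f + N g"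
  using assms by (simp add: seminorm_on_def)

lemma energy_measure_sets:
  assumes "energy_measures m E F \<mu>" "f \<in> F"
  shows "sets (\<mu> f) = sets borel"
  using assms by (auto simp: energy_measures_def radon_measure_def)

lemma energy_measure_UNIV:
  assumes "energy_measures m E F \<mu>" "f \<in> F"
  shows "emeasure (\<mu> f) UNIV = ennreal (E f)"
  using assms by (auto simp: energy_measures_def)

text \<open>The total mass is the real number \<open>E f\<close>. Finiteness is what continuity from
  above requires later.\<close>

lemma energy_measure_finite:
  assumes "energy_measures m E F \<mu>" "f \<in> F"
  shows "emeasure (\<mu> f) A \<noteq> \<infinity>"
proof -
  have "emeasure (\<mu> f) A \<le> emeasure (\<mu> f) UNIV"
    using energy_measure_sets[OF assms] by (intro emeasure_mono) auto
  then show ?thesis using energy_measure_UNIV[OF assms] by (auto simp: top_unique)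
qed

lemma energy_measure_local:
  assumes "energy_measures m E F \<mu>" "f \<in> F \<inter> Cc" "g \<in> F \<inter> Cc" "A \<in> sets borel"
    and "\<And>x. x \<in> A \<Longrightarrow> f x - g x = c"
  shows "emeasure (\<mu> f) A = emeasure (\<mu> g) A"
proof -
  have "\<forall>f\<in>F \<inter> Cc. \<forall>g\<in>F \<inter> Cc. \<forall>A\<in>sets borel.
      (\<lambda>x. f x - g x) constant_on A \<longrightarrow> emeasure (\<mu> f) A = emeasure (\<mu> g) A"
    using assms(1) unfolding energy_measures_def by (elim conjE)
  moreover have "(\<lambda>x. f x - g x) constant_on A" using assms(5) by (auto simp: constant_on_def)
  ultimately show ?thesis using assms(2-4) by simp
qed

lemma energy_measure_continuous:
  assumes "energy_measures m E F \<mu>" "f \<in> F" "\<And>n. u n \<in> F" "A \<in> sets borel"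
    and "(\<lambda>n. E (\<lambda>x. f x - u n x)) \<longlonglongrightarrow> 0"
  shows "(\<lambda>n. emeasure (\<mu> (u n)) A) \<longlonglongrightarrow> emeasure (\<mu> f) A"
proof -
  have "\<forall>f\<in>F. \<forall>u. (\<forall>n::nat. u n \<in> F) \<and> (\<lambda>n. E (\<lambda>x. f x - u n x)) \<longlonglongrightarrow> 0 \<longrightarrow>
      (\<forall>A\<in>sets borel. (\<lambda>n. emeasure (\<mu> (u n)) A) \<longlonglongrightarrow> emeasure (\<mu> f) A)"
    using assms(1) unfolding energy_measures_def by (elim conjE)
  from this[rule_format, of f u A] show ?thesis using assms(2-5) by simp
qed

text \<open>Locality applied to \<open>f\<close> and \<open>-g\<close>, combined with the symmetry
  of the measures under a change of sign.\<close>

lemma energy_measure_local_reflect: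
  assumes L: "L0_subspace m F" and \<mu>: "energy_measures m E F \<mu>"
    and f: "f \<in> F \<inter> Cc" and g: "g \<in> F \<inter> Cc" and A: "A \<in> sets borel"
    and eq: "\<And>x. x \<in> A \<Longrightarrow> f x + g x = c"
  shows "emeasure (\<mu> f) A = emeasure (\<mu> g) A"
proof -
  have g': "(\<lambda>x. - g x) \<in> F \<inter> Cc" using core_scale[OF L g, of "-1"] by simp
  have "emeasure (\<mu> f) A = emeasure (\<mu> (\<lambda>x. - g x)) A"
    using energy_measure_local[OF \<mu> f g' A, of c] eq by simp
  also have "\<mu> (\<lambda>x. - g x) = \<mu> g" using \<mu> g unfolding energy_measures_def by auto
  finally show ?thesis .
qed

text \<open>On \<open>A\<close> locality compares \<open>f\<close> with the zero function, whose
  measure has total mass 0 because \<open>E\<close> vanishes at 0 by homogeneity.\<close>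

lemma energy_measure_zero_set:
  assumes ef: "energy_form p m E F" and p: "1 < p" and \<mu>: "energy_measures m E F \<mu>"
    and f: "f \<in> F \<inter> Cc" and A: "A \<in> sets borel" and f0: "\<And>x. x \<in> A \<Longrightarrow> f x = 0"
  shows "emeasure (\<mu> f) A = 0"
proof -
  have L: "L0_subspace m F" and N: "seminorm_on F (\<lambda>f. E f powr (1 / p))"
    using ef by (auto simp: energy_form_def)
  have z: "(\<lambda>x. 0) \<in> F \<inter> Cc" by (rule core_zero[OF L])
  have "E (\<lambda>x. 0) = 0" using seminorm_on_scale[OF N, of "\<lambda>x. 0" 0] z by simp
  moreover have "emeasure (\<mu> (\<lambda>x. 0)) A \<le> emeasure (\<mu> (\<lambda>x. 0)) UNIV"
    using z energy_measure_sets[OF \<mu>] by (intro emeasure_mono) auto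
  ultimately have "emeasure (\<mu> (\<lambda>x. 0)) A = 0" using energy_measure_UNIV[OF \<mu>] z by simp
  moreover have "emeasure (\<mu> f) A = emeasure (\<mu> (\<lambda>x. 0)) A"
    using f0 by (intro energy_measure_local[OF \<mu> f z A, where c = 0]) simp
  ultimately show ?thesis by simp
qed

section \<open>Folding the range without changing the energy measure\<close>

text \<open>Split \<open>A\<close> along \<open>S\<close>: on one piece \<open>g - f\<close> is
  constant, on the other \<open>g + f\<close> is, so locality applies to the first and its reflected
  form to the second.\<close>

lemma energy_measure_fold:
  assumes L: "L0_subspace m F" and \<mu>: "energy_measures m E F \<mu>"
    and f: "f \<in> F \<inter> Cc" and g: "g \<in> F \<inter> Cc" and S: "S \<in> sets borel"
    and inside: "\<And>x. x \<in> S \<Longrightarrow> g x = f x" and outside: "\<And>x. x \<notin> S \<Longrightarrow> g x = c - f x"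
    and A: "A \<in> sets borel"
  shows "emeasure (\<mu> g) A = emeasure (\<mu> f) A"
proof -
  have split: "emeasure (\<mu> h) A = emeasure (\<mu> h) (A \<inter> S) + emeasure (\<mu> h) (A - S)"
    if "h \<in> F \<inter> Cc" for h
  proof -
    have "emeasure (\<mu> h) (A \<inter> S \<union> (A - S)) = emeasure (\<mu> h) (A \<inter> S) + emeasure (\<mu> h) (A - S)"
      using that A S energy_measure_sets[OF \<mu>] by (intro plus_emeasure[symmetric]) auto
    then show ?thesis by (simp add: Int_Diff_Un)
  qed
  have "emeasure (\<mu> g) (A \<inter> S) = emeasure (\<mu> f) (A \<inter> S)"
    using A S inside by (intro energy_measure_local[OF \<mu> g f, where c = 0]) auto
  moreover have "emeasure (\<mu> g) (A - S) = emeasure (\<mu> f) (A - S)"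
    using A S outside by (intro energy_measure_local_reflect[OF L \<mu> g f, where c = c]) auto
  ultimately show ?thesis using split f g by simp
qed

lemma core_measurable:
  assumes "f \<in> F \<inter> Cc"
  shows "f \<in> borel_measurable borel"
  using assms by (auto simp: Cc_def intro: borel_measurable_continuous_onI)

text \<open>The form and the measures are quantified inside the conclusion so that one and the same
  \<open>h\<close> serves both \<open>\<mu>\<close> and \<open>\<nu>\<close>. Each fold halves the
  upper bound, starting from a bound \<open>M\<close> of \<open>\<bar>f\<bar>\<close>.\<close>

lemma folding:
  assumes L: "L0_subspace m F" and E2: "E2 E0 F" and f: "f \<in> F \<inter> Cc" and \<epsilon>: "0 < \<epsilon>"
  obtains h where "h \<in> F \<inter> Cc" "\<And>x. 0 \<le> h x" "\<And>x. h x \<le> \<epsilon>"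
    "\<And>E \<mu> A. energy_measures m E F \<mu> \<Longrightarrow> A \<in> sets borel \<Longrightarrow>
       emeasure (\<mu> h) A = emeasure (\<mu> f) A"
proof -
  obtain M where M: "0 < M" "\<And>x. \<bar>f x\<bar> \<le> M" using Cc_bounded f by blast
  have "\<exists>h\<in>F \<inter> Cc. (\<forall>x. 0 \<le> h x \<and> h x \<le> M / 2 ^ n) \<and>
     (\<forall>E \<mu>. energy_measures m E F \<mu> \<longrightarrow>
        (\<forall>A\<in>sets borel. emeasure (\<mu> h) A = emeasure (\<mu> f) A))" for n :: nat
  proof (induction n)
    case 0
    \<comment> \<open>The first fold is at level 0 and brings the range into
      \<open>[0, M]\<close>.\<close>
    have abs: "(\<lambda>x. \<bar>f x\<bar>) \<in> F \<inter> Cc" by (rule core_abs[OF L E2 f])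
    have [measurable]: "f \<in> borel_measurable borel" by (rule core_measurable[OF f])
    have "emeasure (\<mu> (\<lambda>x. \<bar>f x\<bar>)) A = emeasure (\<mu> f) A"
      if "energy_measures m E F \<mu>" "A \<in> sets borel" for E \<mu> A
      by (rule energy_measure_fold[OF L that(1) f abs, where S = "{x. 0 \<le> f x}" and c = 0])
        (use that(2) in auto)
    then show ?case using abs M(2) by (intro bexI[of _ "\<lambda>x. \<bar>f x\<bar>"]) auto
  next
    case (Suc n)
    then obtain h where h: "h \<in> F \<inter> Cc" "\<And>x. 0 \<le> h x" "\<And>x. h x \<le> M / 2 ^ n"
      and \<mu>h: "\<And>E \<mu> A. energy_measures m E F \<mu> \<Longrightarrow> A \<in> sets borel \<Longrightarrow>
         emeasure (\<mu> h) A = emeasure (\<mu> f) A"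
      by blast
    \<comment> \<open>\<open>c\<close> is the midpoint of the current range
      \<open>[0, 2 * c]\<close>. The function \<open>k\<close> keeps the values up to
      \<open>c\<close> and reflects a larger value \<open>y\<close> to \<open>2 * c - y\<close>, so
      its range is contained in \<open>[0, c]\<close>.\<close>
    define c where "c = M / 2 ^ Suc n"
    have c: "0 < c" "M / 2 ^ n = 2 * c" using M(1) by (auto simp: c_def)
    define k where "k = (\<lambda>x. h x - 2 * max (h x - c) 0)"
    have k: "k \<in> F \<inter> Cc"
      unfolding k_def by (rule core_diff[OF L h(1) core_scale[OF L core_excess[OF L E2 h(1) c(1)]]])
    have [measurable]: "h \<in> borel_measurable borel" by (rule core_measurable[OF h(1)])
    have "emeasure (\<mu> k) A = emeasure (\<mu> h) A"
      if "energy_measures m E F \<mu>" "A \<in> sets borel" for E \<mu> A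
      by (rule energy_measure_fold[OF L that(1) h(1) k, where S = "{x. h x \<le> c}" and c = "2 * c"])
        (use that(2) in \<open>auto simp: k_def\<close>)
    moreover have "0 \<le> k x \<and> k x \<le> M / 2 ^ Suc n" for x
      using h(2)[of x] h(3)[of x] c unfolding k_def c_def[symmetric] by (auto simp: max_def)
    ultimately show ?case using k \<mu>h by (intro bexI[of _ k]) auto
  qed
  moreover obtain n :: nat where "M / 2 ^ n \<le> \<epsilon>"
  proof -
    obtain n where "M / \<epsilon> < 2 ^ n" using real_arch_pow[of 2 "M / \<epsilon>"] by auto
    then show ?thesis using that \<epsilon> by (auto simp: field_simps intro: less_imp_le)
  qed
  ultimately show ?thesis using that by (meson order_trans)
qed

section \<open>Localisation to positivity sets of core functions\<close>

lemma energy_measure_mono_positivity_set: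
  assumes p: "1 < p" and ef': "energy_form p m E' F" and E2: "E2 E F"
    and \<mu>: "energy_measures m E F \<mu>" and \<nu>: "energy_measures m E' F \<nu>"
    and le: "\<forall>f\<in>F \<inter> Cc. E f \<le> E' f"
    and f: "f \<in> F \<inter> Cc" and \<phi>: "\<phi> \<in> F \<inter> Cc" and \<phi>0: "\<And>x. 0 \<le> \<phi> x"
  shows "emeasure (\<mu> f) {x. 0 < \<phi> x} \<le> emeasure (\<nu> f) {x. 0 < \<phi> x}"
proof -
  have L: "L0_subspace m F" using ef' by (auto simp: energy_form_def)
  define \<epsilon> where "\<epsilon> n = 1 / real (Suc n)" for n
  have \<epsilon>0: "0 < \<epsilon> n" for n by (simp add: \<epsilon>_def)
  have \<epsilon>mono: "\<epsilon> j \<le> \<epsilon> i" if "i \<le> j" for i j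
    using that by (auto simp: \<epsilon>_def frac_le)
  have \<epsilon>small: "\<exists>n. \<epsilon> n < y" if "0 < y" for y
    using reals_Archimedean[OF that] by (auto simp: \<epsilon>_def inverse_eq_divide)
  have [measurable]: "\<phi> \<in> borel_measurable borel" by (rule core_measurable[OF \<phi>])
  \<comment> \<open>\<open>P n\<close> increases to the positivity set of \<open>\<phi>\<close>, and
    the layer \<open>Q n\<close> left over decreases to the empty set.\<close>
  define P where "P n = {x. \<epsilon> n \<le> \<phi> x}" for n
  define Q where "Q n = {x. 0 < \<phi> x \<and> \<phi> x < \<epsilon> n}" for n
  have meas: "P n \<in> sets borel" "Q n \<in> sets borel" "{x. 0 < \<phi> x} \<in> sets borel" for n
    by (simp_all add: P_def Q_def)
  have bound: "emeasure (\<mu> f) (P n) \<le> emeasure (\<nu> f) {x. 0 < \<phi> x} + emeasure (\<nu> \<phi>) (Q n)" for n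
  proof -
    obtain h where h: "h \<in> F \<inter> Cc" "\<And>x. 0 \<le> h x" "\<And>x. h x \<le> \<epsilon> n"
      and hm: "\<And>E \<mu> A. energy_measures m E F \<mu> \<Longrightarrow> A \<in> sets borel \<Longrightarrow>
         emeasure (\<mu> h) A = emeasure (\<mu> f) A"
      using folding[OF L E2 f \<epsilon>0[of n]] by blast
    define g where "g = (\<lambda>x. min (h x) (\<phi> x))"
    have g: "g \<in> F \<inter> Cc" unfolding g_def by (rule core_min[OF L E2 h(1) \<phi>])
    have sg: "sets (\<nu> g) = sets borel" using energy_measure_sets[OF \<nu>] g by simp
    have [measurable]: "h \<in> borel_measurable borel" by (rule core_measurable[OF h(1)])
    have pieces: "{x. \<phi> x = 0} \<in> sets (\<nu> g)" "{x. 0 < \<phi> x \<and> h x \<le> \<phi> x} \<in> sets (\<nu> g)"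
        "{x. 0 < \<phi> x \<and> \<phi> x < h x} \<in> sets (\<nu> g)"
      unfolding sg by measurable
    \<comment> \<open>On \<open>P n\<close> one has
      \<open>h \<le> \<epsilon> n \<le> \<phi>\<close>, hence \<open>g = h\<close>.\<close>
    have "emeasure (\<mu> f) (P n) = emeasure (\<mu> g) (P n)"
      unfolding hm[OF \<mu> meas(1), symmetric]
      by (rule energy_measure_local[OF \<mu> h(1) g meas(1), where c = 0])
        (use h(3) in \<open>auto simp: P_def g_def intro!: min_absorb1[symmetric] intro: order_trans\<close>)
    also have "\<dots> \<le> emeasure (\<mu> g) UNIV"
      using energy_measure_sets[OF \<mu>] g by (intro emeasure_mono) auto
    also have "\<dots> \<le> emeasure (\<nu> g) UNIV"
      \<comment> \<open>The two forms are compared here, through total masses. The remaining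
        estimates concern \<open>\<nu>\<close> alone.\<close>
      using energy_measure_UNIV[OF \<mu>] energy_measure_UNIV[OF \<nu>] g le by (simp add: ennreal_leI)
    \<comment> \<open>On the three pieces \<open>g\<close> equals 0, \<open>h\<close> and
      \<open>\<phi>\<close> respectively, and locality evaluates each. The last piece lies in
      \<open>Q n\<close> because \<open>h \<le> \<epsilon> n\<close>.\<close>
    also have "\<dots> \<le> emeasure (\<nu> g)
        ({x. \<phi> x = 0} \<union> ({x. 0 < \<phi> x \<and> h x \<le> \<phi> x} \<union> {x. 0 < \<phi> x \<and> \<phi> x < h x}))"
    proof (rule emeasure_mono)
      show "UNIV \<subseteq> {x. \<phi> x = 0} \<union> ({x. 0 < \<phi> x \<and> h x \<le> \<phi> x} \<union> {x. 0 < \<phi> x \<and> \<phi> x < h x})"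
        using \<phi>0 by (auto simp: not_le less_le)
      show "{x. \<phi> x = 0} \<union> ({x. 0 < \<phi> x \<and> h x \<le> \<phi> x} \<union> {x. 0 < \<phi> x \<and> \<phi> x < h x}) \<in> sets (\<nu> g)"
        by (intro sets.Un pieces)
    qed
    also have "\<dots> \<le> emeasure (\<nu> g) {x. \<phi> x = 0} +
        (emeasure (\<nu> g) {x. 0 < \<phi> x \<and> h x \<le> \<phi> x} + emeasure (\<nu> g) {x. 0 < \<phi> x \<and> \<phi> x < h x})"
      by (rule order_trans[OF emeasure_subadditive[OF pieces(1) sets.Un[OF pieces(2,3)]]
            add_left_mono[OF emeasure_subadditive[OF pieces(2,3)]]])
    also have "emeasure (\<nu> g) {x. \<phi> x = 0} = 0"
      by (rule energy_measure_zero_set[OF ef' p \<nu> g]) (use h(2) in \<open>auto simp: g_def min_absorb2\<close>)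
    also have "emeasure (\<nu> g) {x. 0 < \<phi> x \<and> h x \<le> \<phi> x} = emeasure (\<nu> h) {x. 0 < \<phi> x \<and> h x \<le> \<phi> x}"
      by (rule energy_measure_local[OF \<nu> g h(1), where c = 0]) (auto simp: g_def)
    also have "\<dots> \<le> emeasure (\<nu> h) {x. 0 < \<phi> x}"
      using energy_measure_sets[OF \<nu>] h(1) meas(3) by (intro emeasure_mono) auto
    also have "\<dots> = emeasure (\<nu> f) {x. 0 < \<phi> x}" by (rule hm[OF \<nu> meas(3)])
    also have "emeasure (\<nu> g) {x. 0 < \<phi> x \<and> \<phi> x < h x} = emeasure (\<nu> \<phi>) {x. 0 < \<phi> x \<and> \<phi> x < h x}"
      by (rule energy_measure_local[OF \<nu> g \<phi>, where c = 0]) (auto simp: g_def)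
    also have "\<dots> \<le> emeasure (\<nu> \<phi>) (Q n)"
      using energy_measure_sets[OF \<nu>] \<phi> meas(2) h(3)
      by (intro emeasure_mono) (auto simp: Q_def intro: less_le_trans)
    finally show ?thesis by simp
  qed
  have "(\<lambda>n. emeasure (\<mu> f) (P n)) \<longlonglongrightarrow> emeasure (\<mu> f) (\<Union>n. P n)"
    using meas(1) energy_measure_sets[OF \<mu>] f
    by (intro Lim_emeasure_incseq) (auto simp: incseq_def P_def intro: order_trans[OF \<epsilon>mono])
  also have "(\<Union>n. P n) = {x. 0 < \<phi> x}"
  proof (intro set_eqI iffI)
    fix x assume "x \<in> (\<Union>n. P n)"
    then obtain n where "\<epsilon> n \<le> \<phi> x" by (auto simp: P_def)
    then show "x \<in> {x. 0 < \<phi> x}" using \<epsilon>0[of n] by simp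
  next
    fix x assume "x \<in> {x. 0 < \<phi> x}"
    then obtain n where "\<epsilon> n < \<phi> x" using \<epsilon>small by blast
    then have "x \<in> P n" by (simp add: P_def)
    then show "x \<in> (\<Union>n. P n)" by blast
  qed
  finally have lim\<mu>: "(\<lambda>n. emeasure (\<mu> f) (P n)) \<longlonglongrightarrow> emeasure (\<mu> f) {x. 0 < \<phi> x}" .
  have "(\<lambda>n. emeasure (\<nu> \<phi>) (Q n)) \<longlonglongrightarrow> emeasure (\<nu> \<phi>) (\<Inter>n. Q n)"
    using meas(2) energy_measure_sets[OF \<nu>] energy_measure_finite[OF \<nu>] \<phi>
    by (intro Lim_emeasure_decseq) (auto simp: decseq_def Q_def intro: less_le_trans[OF _ \<epsilon>mono])
  also have "(\<Inter>n. Q n) = {}"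
  proof (intro equals0I)
    fix x assume "x \<in> (\<Inter>n. Q n)"
    then have x: "0 < \<phi> x" "\<phi> x < \<epsilon> n" for n by (auto simp: Q_def)
    then obtain n where "\<epsilon> n < \<phi> x" using \<epsilon>small by blast
    with x(2)[of n] show False by simp
  qed
  finally have "(\<lambda>n. emeasure (\<nu> \<phi>) (Q n)) \<longlonglongrightarrow> 0" by simp
  then have "(\<lambda>n. emeasure (\<nu> f) {x. 0 < \<phi> x} + emeasure (\<nu> \<phi>) (Q n))
      \<longlonglongrightarrow> emeasure (\<nu> f) {x. 0 < \<phi> x} + 0"
    by (intro tendsto_add tendsto_const)
  from LIMSEQ_le[OF lim\<mu> this] bound show ?thesis by auto
qed

section \<open>Separation of compact sets and regularity\<close>

text \<open>Local compactness gives an open \<open>U\<close> around \<open>K\<close> inside a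
  compact \<open>C\<close>. Urysohn's lemma for \<open>K\<close> and the complement of
  \<open>U \<inter> V\<close> then yields a function whose support stays in
  \<open>C\<close>.\<close>

lemma Cc_Urysohn:
  fixes K V :: "'a::metric_space set"
  assumes lc: "locally_compact_space (euclidean :: 'a topology)"
    and K: "compact K" and V: "open V" "K \<subseteq> V"
  obtains \<psi> where "\<psi> \<in> Cc" "\<And>x. x \<in> K \<Longrightarrow> \<psi> x = 1" "\<And>x. x \<notin> V \<Longrightarrow> \<psi> x = 0"
proof -
  obtain U C where UC: "open U" "compact C" "K \<subseteq> U" "U \<subseteq> C"
    using lc K locally_compact_space_compact_closed_compact[of "euclidean :: 'a topology"]
    by (auto simp: Hausdorff_space_euclidean)
  have "normal_space (euclidean :: 'a topology)"
    by (simp add: metrizable_imp_normal_space metrizable_space_euclidean)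
  moreover have "closedin euclidean (- (U \<inter> V))" "closedin euclidean K"
    "disjnt (- (U \<inter> V)) K"
    using UC V K by (auto simp: disjnt_def compact_imp_closed)
  ultimately obtain \<psi> :: "'a \<Rightarrow> real"
    where \<psi>: "continuous_map euclidean (top_of_set {0..1}) \<psi>"
      "\<psi> ` (- (U \<inter> V)) \<subseteq> {0}" "\<psi> ` K \<subseteq> {1}"
    using Urysohn_lemma[of "euclidean :: 'a topology" "- (U \<inter> V)" K 0 1] by auto
  have "continuous_on UNIV \<psi>" using \<psi>(1) by (simp add: continuous_map_in_subtopology)
  moreover have "supp \<psi> \<subseteq> C"
    unfolding supp_def using \<psi>(2) UC by (intro closure_minimal) (auto simp: compact_imp_closed)
  then have "compact (supp \<psi>)"
    by (metis UC(2) closed_closure compact_Int_closed inf.absorb2 supp_def)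
  ultimately show ?thesis using that[of \<psi>] \<psi> by (auto simp: Cc_def)
qed

text \<open>A core function within \<open>1 / 3\<close> of a Urysohn function exceeds
  \<open>2 / 3\<close> on \<open>K\<close> and stays below \<open>1 / 3\<close> off
  \<open>V\<close>. Its excess over \<open>1 / 3\<close> is therefore positive on \<open>K\<close>
  and exactly zero off \<open>V\<close>.\<close>

lemma core_Urysohn:
  fixes K V :: "'a::metric_space set"
  assumes lc: "locally_compact_space (euclidean :: 'a topology)"
    and L: "L0_subspace m F" and E2: "E2 E F" and dense: "dense_wrt sup_norm (F \<inter> Cc) Cc"
    and K: "compact K" and V: "open V" "K \<subseteq> V"
  obtains \<phi> where "\<phi> \<in> F \<inter> Cc" "\<And>x. 0 \<le> \<phi> x" "K \<subseteq> {x. 0 < \<phi> x}" "{x. 0 < \<phi> x} \<subseteq> V"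
proof -
  obtain \<psi> where \<psi>: "\<psi> \<in> Cc" "\<And>x. x \<in> K \<Longrightarrow> \<psi> x = 1" "\<And>x. x \<notin> V \<Longrightarrow> \<psi> x = 0"
    using Cc_Urysohn[OF lc K V] by blast
  obtain h where h: "h \<in> F \<inter> Cc" "sup_norm (\<lambda>x. \<psi> x - h x) < 1 / 3"
    using dense \<psi>(1) unfolding dense_wrt_def by (meson zero_less_divide_1_iff zero_less_numeral)
  have "(\<lambda>x. \<psi> x - h x) \<in> Cc"
    using Cc_add[OF \<psi>(1) Cc_scale[of h "-1"]] h(1) by simp
  from sup_norm_upper[OF this] h(2) have near: "\<bar>\<psi> x - h x\<bar> < 1 / 3" for x
    by (meson le_less_trans)
  have "0 < max (h x - 1 / 3) 0" if "x \<in> K" for x using near[of x] \<psi>(2)[OF that] by (auto simp: abs_if max_def split: if_splits)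
  moreover have "max (h x - 1 / 3) 0 = 0" if "x \<notin> V" for x
    using near[of x] \<psi>(3)[OF that] by auto
  ultimately show ?thesis
    using that[OF core_excess[OF L E2 h(1), of "1 / 3"]] by fastforce
qed

text \<open>The open neighbourhoods of radius \<open>1 / (n + 1)\<close> decrease to the compact set
  \<open>K\<close>, and continuity from above carries the bound to the limit.\<close>

lemma compact_outer_regular:
  fixes K :: "'a::metric_space set"
  assumes M: "sets M = sets borel" and fin: "\<And>A. emeasure M A \<noteq> \<infinity>"
    and K: "compact K" and le: "\<And>V. open V \<Longrightarrow> K \<subseteq> V \<Longrightarrow> b \<le> emeasure M V"
  shows "b \<le> emeasure M K"
proof (cases "K = {}")
  case True
  then show ?thesis using le[of "{}"] by simp
next
  \<comment> \<open>The distance to the empty set is 0 by convention, so for empty \<open>K\<close>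
    these neighbourhoods would be the whole space.\<close>
  case False
  define V where "V n = {x. infdist x K < 1 / real (Suc n)}" for n
  have V: "open (V n)" for n
    unfolding V_def by (intro open_Collect_less continuous_intros)
  have KV: "K \<subseteq> V n" for n by (auto simp: V_def)
  have dec: "decseq V"
  proof (rule decseq_SucI)
    fix n
    have "1 / real (Suc (Suc n)) \<le> 1 / real (Suc n)" by (simp add: frac_le)
    then show "V (Suc n) \<subseteq> V n" unfolding V_def by force
  qed
  have "x \<in> K" if "x \<in> (\<Inter>n. V n)" for x
  proof (rule ccontr)
    assume "x \<notin> K"
    then have "0 < infdist x K"
      using infdist_pos_not_in_closed[OF compact_imp_closed[OF K] False] by simp
    then obtain n where "1 / real (Suc n) < infdist x K"
      using reals_Archimedean by (metis inverse_eq_divide)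
    with that show False by (auto simp: V_def dest!: spec[of _ n])
  qed
  then have "(\<Inter>n. V n) = K" using KV by blast
  moreover have "(\<lambda>n. emeasure M (V n)) \<longlonglongrightarrow> emeasure M (\<Inter>n. V n)"
    using V M fin dec by (intro Lim_emeasure_decseq) auto
  ultimately show ?thesis
    using le[OF V KV] by (intro LIMSEQ_le_const) auto
qed

text \<open>For compact \<open>K\<close> inside open \<open>V\<close>, a positivity set fits between
  them. Outer regularity of \<open>\<nu> f\<close> at \<open>K\<close> removes \<open>V\<close>, and
  inner regularity of \<open>\<mu> f\<close> extends the comparison from compact to Borel
  sets.\<close>

lemma energy_measure_mono_core:
  fixes m :: "'a::metric_space measure"
  assumes lc: "locally_compact_space (euclidean :: 'a topology)"
    and p: "1 < p" and ef': "energy_form p m E' F" and E2: "E2 E F"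
    and dense: "dense_wrt sup_norm (F \<inter> Cc) Cc"
    and \<mu>: "energy_measures m E F \<mu>" and \<nu>: "energy_measures m E' F \<nu>"
    and le: "\<forall>f\<in>F \<inter> Cc. E f \<le> E' f"
    and f: "f \<in> F \<inter> Cc" and A: "A \<in> sets borel"
  shows "emeasure (\<mu> f) A \<le> emeasure (\<nu> f) A"
proof -
  have L: "L0_subspace m F" using ef' by (auto simp: energy_form_def)
  have sets: "sets (\<mu> f) = sets borel" "sets (\<nu> f) = sets borel"
    using energy_measure_sets[OF \<mu>] energy_measure_sets[OF \<nu>] f by auto
  have compact_le: "emeasure (\<mu> f) K \<le> emeasure (\<nu> f) K" if K: "compact K" for K
  proof (rule compact_outer_regular[OF sets(2) _ K])
    show "emeasure (\<nu> f) B \<noteq> \<infinity>" for B using energy_measure_finite[OF \<nu>] f by simp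
    fix V :: "'a set" assume V: "open V" "K \<subseteq> V"
    obtain \<phi> where \<phi>: "\<phi> \<in> F \<inter> Cc" "\<And>x. 0 \<le> \<phi> x" "K \<subseteq> {x. 0 < \<phi> x}" "{x. 0 < \<phi> x} \<subseteq> V"
      using core_Urysohn[OF lc L E2 dense K V] by blast
    have [measurable]: "\<phi> \<in> borel_measurable borel" by (rule core_measurable[OF \<phi>(1)])
    have "emeasure (\<mu> f) K \<le> emeasure (\<mu> f) {x. 0 < \<phi> x}"
      using \<phi>(3) sets by (intro emeasure_mono) auto
    also have "\<dots> \<le> emeasure (\<nu> f) {x. 0 < \<phi> x}"
      by (rule energy_measure_mono_positivity_set[OF p ef' E2 \<mu> \<nu> le f \<phi>(1,2)])
    also have "\<dots> \<le> emeasure (\<nu> f) V"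
      using \<phi>(4) V sets by (intro emeasure_mono) auto
    finally show "emeasure (\<mu> f) K \<le> emeasure (\<nu> f) V" .
  qed
  have "radon_measure (\<mu> f)" using \<mu> f by (auto simp: energy_measures_def)
  then have "emeasure (\<mu> f) A = (SUP K\<in>{K. compact K \<and> K \<subseteq> A}. emeasure (\<mu> f) K)"
    using A by (auto simp: radon_measure_def)
  also have "\<dots> \<le> emeasure (\<nu> f) A"
  proof (rule SUP_least)
    fix K assume K: "K \<in> {K. compact K \<and> K \<subseteq> A}"
    then have "emeasure (\<mu> f) K \<le> emeasure (\<nu> f) K" using compact_le by simp
    also have "\<dots> \<le> emeasure (\<nu> f) A" using K A sets by (intro emeasure_mono) auto
    finally show "emeasure (\<mu> f) K \<le> emeasure (\<nu> f) A" .
  qed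
  finally show ?thesis .
qed

section \<open>Core sequences that converge in both energies\<close>

lemma Lp_norm_powr:
  assumes "1 < p"
  shows "Lp_norm p m f powr p = (\<integral>x. \<bar>f x\<bar> powr p \<partial>m)"
proof -
  have "0 \<le> (\<integral>x. \<bar>f x\<bar> powr p \<partial>m)" by simp
  then show ?thesis using assms by (simp add: Lp_norm_def powr_powr)
qed

lemma energy_norm_powr:
  assumes "1 < p" "0 \<le> E f"
  shows "energy_norm p m E f powr p = E f + (\<integral>x. \<bar>f x\<bar> powr p \<partial>m)"
proof -
  have "0 \<le> E f + (\<integral>x. \<bar>f x\<bar> powr p \<partial>m)" using assms by simp
  then show ?thesis using assms by (simp add: energy_norm_def powr_powr Lp_norm_powr)
qed

text \<open>The p-th power of the norm is a sum of two nonnegative terms, so each is squeezed to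
  0.\<close>

lemma energy_norm_tendsto_zeroD:
  assumes p: "1 < p" and E: "\<And>n. 0 \<le> E (u n)"
    and lim: "(\<lambda>n. energy_norm p m E (u n)) \<longlonglongrightarrow> 0"
  shows "(\<lambda>n. E (u n)) \<longlonglongrightarrow> 0" "(\<lambda>n. \<integral>x. \<bar>u n x\<bar> powr p \<partial>m) \<longlonglongrightarrow> 0"
proof -
  have nn: "0 \<le> (\<integral>x. \<bar>u n x\<bar> powr p \<partial>m)" for n by simp
  have "(\<lambda>n. energy_norm p m E (u n) powr p) \<longlonglongrightarrow> 0 powr p"
    using lim p by (intro tendsto_powr2) (auto simp: energy_norm_def)
  then have sum: "(\<lambda>n. E (u n) + (\<integral>x. \<bar>u n x\<bar> powr p \<partial>m)) \<longlonglongrightarrow> 0"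
    using energy_norm_powr[where E = E and f = "u n" for n, OF p E] by simp
  show "(\<lambda>n. E (u n)) \<longlonglongrightarrow> 0"
    by (rule tendsto_sandwich[OF _ _ tendsto_const sum]) (use E nn in auto)
  show "(\<lambda>n. \<integral>x. \<bar>u n x\<bar> powr p \<partial>m) \<longlonglongrightarrow> 0"
    by (rule tendsto_sandwich[OF _ _ tendsto_const sum]) (use E nn in auto)
qed

text \<open>A crude substitute for Minkowski's inequality: \<open>\<bar>a + b\<bar>\<close> is at
  most twice the larger of \<open>\<bar>a\<bar>\<close> and \<open>\<bar>b\<bar>\<close>.\<close>

lemma powr_abs_add_le:
  fixes a b p :: real
  assumes "0 \<le> p"
  shows "\<bar>a + b\<bar> powr p \<le> 2 powr p * (\<bar>a\<bar> powr p + \<bar>b\<bar> powr p)"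
proof -
  have "\<bar>a + b\<bar> powr p \<le> (2 * max \<bar>a\<bar> \<bar>b\<bar>) powr p"
    using assms by (intro powr_mono2) auto
  also have "\<dots> = 2 powr p * (max \<bar>a\<bar> \<bar>b\<bar>) powr p" by (simp add: powr_mult)
  also have "\<dots> \<le> 2 powr p * (\<bar>a\<bar> powr p + \<bar>b\<bar> powr p)"
    by (intro mult_left_mono) (auto simp: max_def)
  finally show ?thesis .
qed

text \<open>The integral of \<open>\<bar>f - h\<bar> powr p\<close> is bounded by a constant times a
  sum that tends to 0.\<close>

lemma Lp_limit_unique:
  fixes f h :: "'a \<Rightarrow> real" and u :: "nat \<Rightarrow> 'a \<Rightarrow> real"
  assumes p: "1 < p" and fh: "integrable m (\<lambda>x. \<bar>f x - h x\<bar> powr p)"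
    and int: "\<And>n. integrable m (\<lambda>x. \<bar>f x - u n x\<bar> powr p)"
      "\<And>n. integrable m (\<lambda>x. \<bar>u n x - h x\<bar> powr p)"
    and lim: "(\<lambda>n. \<integral>x. \<bar>f x - u n x\<bar> powr p \<partial>m) \<longlonglongrightarrow> 0"
      "(\<lambda>n. \<integral>x. \<bar>u n x - h x\<bar> powr p \<partial>m) \<longlonglongrightarrow> 0"
  shows "AE x in m. f x = h x"
proof -
  have bound: "(\<integral>x. \<bar>f x - h x\<bar> powr p \<partial>m) \<le>
      2 powr p * ((\<integral>x. \<bar>f x - u n x\<bar> powr p \<partial>m) + (\<integral>x. \<bar>u n x - h x\<bar> powr p \<partial>m))" for n
  proof -
    have "(\<integral>x. \<bar>f x - h x\<bar> powr p \<partial>m) \<le>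
        (\<integral>x. 2 powr p * (\<bar>f x - u n x\<bar> powr p + \<bar>u n x - h x\<bar> powr p) \<partial>m)"
    proof (rule integral_mono)
      show "\<bar>f x - h x\<bar> powr p \<le> 2 powr p * (\<bar>f x - u n x\<bar> powr p + \<bar>u n x - h x\<bar> powr p)" for x
        using powr_abs_add_le[of p "f x - u n x" "u n x - h x"] p by simp
    qed (use fh int in auto)
    then show ?thesis using int by simp
  qed
  have "(\<lambda>n. 2 powr p * ((\<integral>x. \<bar>f x - u n x\<bar> powr p \<partial>m) + (\<integral>x. \<bar>u n x - h x\<bar> powr p \<partial>m)))
      \<longlonglongrightarrow> 2 powr p * (0 + 0)"
    using lim by (intro tendsto_intros)
  from LIMSEQ_le_const[OF this] bound
  have "(\<integral>x. \<bar>f x - h x\<bar> powr p \<partial>m) \<le> 2 powr p * (0 + 0)" by blast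
  moreover have "0 \<le> (\<integral>x. \<bar>f x - h x\<bar> powr p \<partial>m)" by simp
  ultimately have "(\<integral>x. \<bar>f x - h x\<bar> powr p \<partial>m) = 0" by (intro order_antisym) auto
  then have "AE x in m. \<bar>f x - h x\<bar> powr p = 0"
    using integral_nonneg_eq_0_iff_AE[OF fh] by simp
  then show ?thesis by simp
qed

text \<open>The \<open>E'\<close>-approximating sequence is Cauchy for the smaller form \<open>E\<close>; its limit there is the
  same function because both norms control the \<open>L\<^sup>p\<close> norm.\<close>

lemma core_common_approximation:
  assumes p: "1 < p" and ef: "energy_form p m E F" and E1: "E1 p m E F"
    and ef': "energy_form p m E' F" and E1': "E1 p m E' F"
    and dense: "dense_wrt (energy_norm p m E') (F \<inter> Cc) F"
    and le: "\<forall>f\<in>F \<inter> Cc. E f \<le> E' f" and f: "f \<in> F"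
  obtains u where "\<And>n::nat. u n \<in> F \<inter> Cc"
    "(\<lambda>n. E (\<lambda>x. f x - u n x)) \<longlonglongrightarrow> 0" "(\<lambda>n. E' (\<lambda>x. f x - u n x)) \<longlonglongrightarrow> 0"
proof -
  let ?N = "energy_norm p m E" and ?N' = "energy_norm p m E'"
  have L: "L0_subspace m F" using ef by (simp add: energy_form_def)
  have Fadd: "(\<lambda>x. g x + h x) \<in> F" if "g \<in> F" "h \<in> F" for g h
    using L that by (auto simp: L0_subspace_def)
  have Fscale: "(\<lambda>x. c * g x) \<in> F" if "g \<in> F" for g c
    using L that by (auto simp: L0_subspace_def)
  have Fdiff: "(\<lambda>x. g x - h x) \<in> F" if "g \<in> F" "h \<in> F" for g h
    using Fadd[OF that(1) Fscale[OF that(2), of "-1"]] by simp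
  have pos: "0 \<le> E g" "0 \<le> E' g" if "g \<in> F" for g
    using ef ef' that by (auto simp: energy_form_def)
  have int: "integrable m (\<lambda>x. \<bar>g x\<bar> powr p)" if "g \<in> F" for g
    using E1 that by (auto simp: E1_def Lp_space_def)
  have resp: "respects_AE m F E" using ef by (simp add: energy_form_def)
  have NE: "seminorm_on F (\<lambda>f. E f powr (1 / p))" using ef by (simp add: energy_form_def)
  have N': "seminorm_on F ?N'" using E1' by (simp add: E1_def banach_on_def)
  have "\<exists>g\<in>F \<inter> Cc. ?N' (\<lambda>x. f x - g x) < 1 / real (Suc n)" for n
    using dense f unfolding dense_wrt_def by simp
  then obtain u where u: "\<And>n. u n \<in> F \<inter> Cc" "\<And>n. ?N' (\<lambda>x. f x - u n x) < 1 / real (Suc n)"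
    by metis
  have uF: "u n \<in> F" for n using u(1) by blast
  have "?N' (\<lambda>x. f x - u n x) \<ge> 0" for n by (simp add: energy_norm_def)
  then have lim': "(\<lambda>n. ?N' (\<lambda>x. f x - u n x)) \<longlonglongrightarrow> 0"
    by (intro tendsto_sandwich[OF _ _ tendsto_const LIMSEQ_Suc[OF lim_1_over_n]])
      (auto intro!: always_eventually less_imp_le[OF u(2), simplified])
  \<comment> \<open>The inequality of the energies is given on the core only, so it is applied to
    \<open>u i - u j\<close> and not to \<open>f - u i\<close>. The triangle inequality then runs in
    the larger norm.\<close>
  have NN': "?N (\<lambda>x. u i x - u j x) \<le> ?N' (\<lambda>x. f x - u i x) + ?N' (\<lambda>x. f x - u j x)" for i j
  proof -
    let ?v = "\<lambda>x. u i x - u j x"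
    have v: "?v \<in> F \<inter> Cc" by (rule core_diff[OF L u(1) u(1)])
    have "?N ?v \<le> ?N' ?v"
      unfolding energy_norm_def using p le v pos(1) by (intro powr_mono2 add_right_mono) auto
    also have "?N' ?v = ?N' (\<lambda>x. -1 * (f x - u i x) + (f x - u j x))" by simp
    also have "\<dots> \<le> ?N' (\<lambda>x. -1 * (f x - u i x)) + ?N' (\<lambda>x. f x - u j x)"
      by (rule seminorm_on_triangle[OF N' Fscale[OF Fdiff[OF f uF]] Fdiff[OF f uF]])
    also have "?N' (\<lambda>x. -1 * (f x - u i x)) = \<bar>-1\<bar> * ?N' (\<lambda>x. f x - u i x)"
      by (rule seminorm_on_scale[OF N' Fdiff[OF f uF]])
    finally show ?thesis by simp
  qed
  have "\<exists>n0. \<forall>i\<ge>n0. \<forall>j\<ge>n0. ?N (\<lambda>x. u i x - u j x) < \<epsilon>" if \<epsilon>: "0 < \<epsilon>" for \<epsilon>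
  proof -
    obtain n0 where n0: "\<And>n. n \<ge> n0 \<Longrightarrow> ?N' (\<lambda>x. f x - u n x) < \<epsilon> / 2"
      using order_tendstoD(2)[OF lim', of "\<epsilon> / 2"] \<epsilon> by (auto simp: eventually_sequentially)
    have "?N (\<lambda>x. u i x - u j x) < \<epsilon>" if "i \<ge> n0" "j \<ge> n0" for i j
      using NN'[of i j] n0[OF that(1)] n0[OF that(2)] by linarith
    then show ?thesis by blast
  qed
  then obtain h where h: "h \<in> F" "(\<lambda>n. ?N (\<lambda>x. u n x - h x)) \<longlonglongrightarrow> 0"
    using E1 uF unfolding E1_def banach_on_def by blast
  note lims' = energy_norm_tendsto_zeroD[OF p pos(2)[OF Fdiff[OF f uF]] lim']
  note lims = energy_norm_tendsto_zeroD[OF p pos(1)[OF Fdiff[OF uF h(1)]] h(2)]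
  have fh: "AE x in m. f x = h x"
    by (rule Lp_limit_unique[OF p _ _ _ lims'(2) lims(2)]) (intro int Fdiff f h(1) uF)+
  \<comment> \<open>\<open>h\<close> may replace \<open>f\<close> because \<open>E\<close> respects
    almost everywhere equality. The change of sign comes from homogeneity of the p-th root, undone
    by raising to the power \<open>p\<close>.\<close>
  have E_eq: "E (\<lambda>x. f x - u n x) = E (\<lambda>x. u n x - h x)" for n
  proof -
    have "AE x in m. u n x - f x = u n x - h x" using fh by auto
    then have "E (\<lambda>x. u n x - f x) = E (\<lambda>x. u n x - h x)"
      by (rule respects_AED[OF resp Fdiff[OF uF f] Fdiff[OF uF h(1)]])
    moreover have "E (\<lambda>x. f x - u n x) powr (1 / p) = E (\<lambda>x. u n x - f x) powr (1 / p)"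
      using seminorm_on_scale[OF NE Fdiff[OF uF f], of "-1" n] by simp
    then have "(E (\<lambda>x. f x - u n x) powr (1 / p)) powr p = (E (\<lambda>x. u n x - f x) powr (1 / p)) powr p"
      by simp
    then have "E (\<lambda>x. f x - u n x) = E (\<lambda>x. u n x - f x)"
      using p pos(1)[OF Fdiff[OF uF f]] pos(1)[OF Fdiff[OF f uF]] by (simp add: powr_powr)
    ultimately show ?thesis by simp
  qed
  show ?thesis using that[OF u(1) _ lims'(1)] lims(1) by (simp add: E_eq)
qed

section \<open>Extension from the core to the whole domain\<close>

theorem theorem3p1:
  fixes p :: real
    and m :: "'a::metric_space measure"
    and E E' :: "('a \<Rightarrow> real) \<Rightarrow> real"
    and F :: "('a \<Rightarrow> real) set"
    and \<mu> \<nu> :: "('a \<Rightarrow> real) \<Rightarrow> 'a measure"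
  assumes "1 < p"
    and "locally_compact_space (euclidean :: 'a topology)"
    and "separable_space (euclidean :: 'a topology)"
    and "radon_measure m" and "full_support m"
    and "energy_form p m E F" and "E1 p m E F" and "E2 E F" and "E3 E F" and "E4 p m E F"
    and "energy_form p m E' F" and "E1 p m E' F" and "E2 E' F" and "E3 E' F" and "E4 p m E' F"
    and "energy_measures m E F \<mu>"
    and "energy_measures m E' F \<nu>"
    and "\<forall>f\<in>F \<inter> Cc. E f \<le> E' f"
  shows "\<forall>f\<in>F. \<forall>A\<in>sets borel. emeasure (\<mu> f) A \<le> emeasure (\<nu> f) A"
proof (intro ballI)
  fix f and A :: "'a set" assume f: "f \<in> F" and A: "A \<in> sets borel"
  have dense: "dense_wrt sup_norm (F \<inter> Cc) Cc" "dense_wrt (energy_norm p m E') (F \<inter> Cc) F"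
    using \<open>E4 p m E' F\<close> by (auto simp: E4_def)
  \<comment> \<open>A single sequence converging in both energies lets the continuity condition act
    on \<open>\<mu>\<close> and \<open>\<nu>\<close> along the same core functions, where the
    inequality is known.\<close>
  obtain u where u: "\<And>n::nat. u n \<in> F \<inter> Cc"
    "(\<lambda>n. E (\<lambda>x. f x - u n x)) \<longlonglongrightarrow> 0" "(\<lambda>n. E' (\<lambda>x. f x - u n x)) \<longlonglongrightarrow> 0"
    using core_common_approximation[OF \<open>1 < p\<close> \<open>energy_form p m E F\<close> \<open>E1 p m E F\<close>
        \<open>energy_form p m E' F\<close> \<open>E1 p m E' F\<close> dense(2) \<open>\<forall>f\<in>F \<inter> Cc. E f \<le> E' f\<close> f]
    by blast
  have "(\<lambda>n. emeasure (\<mu> (u n)) A) \<longlonglongrightarrow> emeasure (\<mu> f) A"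
    by (rule energy_measure_continuous[OF \<open>energy_measures m E F \<mu>\<close> f IntD1[OF u(1)] A u(2)])
  moreover have "(\<lambda>n. emeasure (\<nu> (u n)) A) \<longlonglongrightarrow> emeasure (\<nu> f) A"
    by (rule energy_measure_continuous[OF \<open>energy_measures m E' F \<nu>\<close> f IntD1[OF u(1)] A u(3)])
  moreover have "emeasure (\<mu> (u n)) A \<le> emeasure (\<nu> (u n)) A" for n
    by (rule energy_measure_mono_core[OF assms(2) \<open>1 < p\<close> \<open>energy_form p m E' F\<close> \<open>E2 E F\<close> dense(1)
          \<open>energy_measures m E F \<mu>\<close> \<open>energy_measures m E' F \<nu>\<close> \<open>\<forall>f\<in>F \<inter> Cc. E f \<le> E' f\<close> u(1) A])
  ultimately show "emeasure (\<mu> f) A \<le> emeasure (\<nu> f) A"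
    by (intro LIMSEQ_le) auto
qed

end
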